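(* In the semi-synchronous Passive Transport (PT) model without chirality, two anonymous agents are not sufficient to explore a 1-interval connected ring of size $n\ge 5$ (i.e. for no algorithm is every node eventually visited in every execution). The result holds even if there is a distinguished landmark node and the exact ring size $n$ is known to the agents.
   Context: Ring: the nodes $v_0,\dots,v_{n-1}$ (indices modulo $n$) form a cycle; $v_i$ is linked to $v_{i-1}$ and $v_{i+1}$ via distinctly labelled ports $q_{i-}$ and $q_{i+}$ (labels need not be globally consistent). Time proceeds in rounds; in each round at most one edge, chosen by an adversary, is missing (1-interval connected ring). Landmark: one node is different from all others, and an agent performing Look at a node sees whether that node is the landmark; the nodes are otherwise indistinguishable. Agents: each has memory and computational power; they are anonymous (no identifiers) and all execute the same deterministic protocol. They start at arbitrary, not necessarily distinct, nodes, cannot communicate explicitly and cannot mark nodes. Each agent $a_j$ has a consistent private orientation, i.e. a function $\lambda_j$ designating each port left or right with $\lambda_j(q_{i-})=\lambda_j(q_{k-})$ for all $i,k$. Without chirality, the orientations of different agents need not agree (they are chosen adversarially). Round: each active agent performs Look (it sees its own position within its node, i.e. whether it is on a port and which one, and the positions of the other agents at that node), Compute (from this snapshot and its memory it determines a direction in $\{left,right,nil\}$; if $nil$ it becomes inactive; otherwise it tries to access the corresponding port if not already there), and Move. Ports are accessed in mutual exclusion: an occupied port cannot be gained, and if several agents try the same port exactly one succeeds; an agent that fails sets $moved=false$ and becomes inactive. An agent on a port after computing moves to the other endpoint if the edge is present in this round (setting $moved=true$), and otherwise stays on the port (setting $moved=false$); in either case the port is denied to other agents in that round. Two agents crossing the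 same edge in opposite directions in the same round might not detect each other. Semi-synchronous ($\mathcal{SSYNC}$): in each round an adversary activates a non-empty subset of the agents, the others being asleep (passive); every agent is activated infinitely often; an activated agent does not know whether it was active in the previous round. An agent may be asleep on a port. PT model: if an agent is sleeping on a port in round $t$ and the corresponding edge is present in round $t$, the agent is moved to the other endpoint of the edge in round $t$. Exploration is solved if within finite time every node is visited by at least one agent, in every execution (all initial positions, orientations and all adversary choices of activations and missing edges). *)

theory Defs
  imports "HOL-Library.Multiset"
begin

text \<open>The ring has nodes \<open>0, \<dots>, n - 1\<close>. The ports \<open>q\<^sub>i\<^sub>-\<close> and \<open>q\<^sub>i\<^sub>+\<close> of node \<open>i\<close> are the pairs
  \<open>(i, Minus)\<close> and \<open>(i, Plus)\<close>; edge number \<open>i\<close> joins \<open>i\<close> to \<open>(i + 1) mod n\<close>.\<close>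

datatype side = Minus | Plus

type_synonym port = "nat \<times> side"

fun neighbour :: "nat \<Rightarrow> port \<Rightarrow> nat" where
  "neighbour n (v, Plus) = (v + 1) mod n"
| "neighbour n (v, Minus) = (v + n - 1) mod n"

fun port_edge :: "nat \<Rightarrow> port \<Rightarrow> nat" where
  "port_edge n (v, Plus) = v"
| "port_edge n (v, Minus) = (v + n - 1) mod n"


datatype direction = Left | Right

text \<open>A private orientation designates each port left or right, consistently along the ring.\<close>

type_synonym orientation = "port \<Rightarrow> direction"

definition consistent_orientation :: "nat \<Rightarrow> orientation \<Rightarrow> bool" where
  "consistent_orientation n lam \<longleftrightarrow>
     (\<forall>i<n. lam (i, Minus) \<noteq> lam (i, Plus)) \<and>
     (\<forall>i<n. \<forall>k<n. lam (i, Minus) = lam (k, Minus) \<and> lam (i, Plus) = lam (k, Plus))"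

definition port_towards :: "orientation \<Rightarrow> nat \<Rightarrow> direction \<Rightarrow> port" where
  "port_towards lam v d = (if lam (v, Minus) = d then (v, Minus) else (v, Plus))"


text \<open>Port positions in a snapshot are expressed in the observing agent's own orientation, with
  \<open>None\<close> for an agent inside the node. The other agents are anonymous, hence the multiset.\<close>

record snapshot =
  own_position :: "direction option"
  other_positions :: "direction option multiset"
  sees_landmark :: bool

text \<open>A deterministic protocol. The Boolean argument of \<open>compute\<close> is the agent's variable
  \<open>moved\<close>; the returned direction \<open>None\<close> stands for \<open>nil\<close>. The memory type is arbitrary, so that
  the agents' memory and computational power are unrestricted.\<close>

record 'm protocol =
  initial_memory :: 'm
  compute :: "'m \<Rightarrow> bool \<Rightarrow> snapshot \<Rightarrow> 'm \<times> direction option"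

record 'm agent =
  node :: nat
  on_side :: "side option"
  memory :: 'm
  moved :: bool

text \<open>Of a configuration of \<open>k\<close> agents, only the values at \<open>0, \<dots>, k - 1\<close> are relevant.\<close>

type_synonym 'm config = "nat \<Rightarrow> 'm agent"

definition position_seen :: "orientation \<Rightarrow> 'm agent \<Rightarrow> direction option" where
  "position_seen lam a = map_option (\<lambda>s. lam (node a, s)) (on_side a)"

definition look :: "nat option \<Rightarrow> nat \<Rightarrow> orientation \<Rightarrow> 'm config \<Rightarrow> nat \<Rightarrow> snapshot" where
  "look landmark k lam c i =
     \<lparr> own_position = position_seen lam (c i),
       other_positions =
         image_mset (\<lambda>j. position_seen lam (c j))
           (mset_set {j. j < k \<and> j \<noteq> i \<and> node (c j) = node (c i)}),
       sees_landmark = (landmark = Some (node (c i))) \<rparr>"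

definition decision ::
  "nat option \<Rightarrow> nat \<Rightarrow> 'm protocol \<Rightarrow> (nat \<Rightarrow> orientation) \<Rightarrow> 'm config \<Rightarrow> nat
    \<Rightarrow> 'm \<times> direction option" where
  "decision landmark k P lam c i =
     compute P (memory (c i)) (moved (c i)) (look landmark k (lam i) c i)"

definition wanted_port ::
  "nat option \<Rightarrow> nat \<Rightarrow> 'm protocol \<Rightarrow> (nat \<Rightarrow> orientation) \<Rightarrow> 'm config \<Rightarrow> nat
    \<Rightarrow> port option" where
  "wanted_port landmark k P lam c i =
     map_option (port_towards (lam i) (node (c i))) (snd (decision landmark k P lam c i))"

definition on_port :: "'m agent \<Rightarrow> port \<Rightarrow> bool" where
  "on_port a p \<longleftrightarrow> node a = fst p \<and> on_side a = Some (snd p)"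

text \<open>The active agents that try to access a port they do not hold and that no agent occupies at
  the beginning of the round. A port whose occupant leaves it during the round is thus still
  unavailable in that round.\<close>

definition contenders ::
  "nat option \<Rightarrow> nat \<Rightarrow> 'm protocol \<Rightarrow> (nat \<Rightarrow> orientation) \<Rightarrow> 'm config \<Rightarrow> nat set
    \<Rightarrow> port \<Rightarrow> nat set" where
  "contenders landmark k P lam c active p =
     {i \<in> active. wanted_port landmark k P lam c i = Some p \<and> (\<forall>j<k. \<not> on_port (c j) p)}"

text \<open>Mutual exclusion: \<open>winners\<close> contains exactly one contender for each contended port.\<close>

definition valid_winners ::
  "nat option \<Rightarrow> nat \<Rightarrow> 'm protocol \<Rightarrow> (nat \<Rightarrow> orientation) \<Rightarrow> 'm config \<Rightarrow> nat set
    \<Rightarrow> nat set \<Rightarrow> bool" where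
  "valid_winners landmark k P lam c active winners \<longleftrightarrow>
     winners \<subseteq> (\<Union>p. contenders landmark k P lam c active p) \<and>
     (\<forall>p. contenders landmark k P lam c active p \<noteq> {} \<longrightarrow>
        (\<exists>!i. i \<in> winners \<inter> contenders landmark k P lam c active p))"

text \<open>An agent that computes \<open>nil\<close> or fails to gain a port becomes inactive at its current
  position. It is not asleep, so even on a port it is not transported in that round.\<close>

definition active_update ::
  "nat \<Rightarrow> nat option \<Rightarrow> nat \<Rightarrow> 'm protocol \<Rightarrow> (nat \<Rightarrow> orientation) \<Rightarrow> nat option
    \<Rightarrow> nat set \<Rightarrow> 'm config \<Rightarrow> nat \<Rightarrow> 'm agent" where
  "active_update n landmark k P lam missing winners c i =
     (let a = (c i)\<lparr> memory := fst (decision landmark k P lam c i) \<rparr>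
      in case wanted_port landmark k P lam c i of
           None \<Rightarrow> a
         | Some p \<Rightarrow>
             if on_port a p \<or> i \<in> winners then
               (if missing = Some (port_edge n p)
                then a\<lparr> on_side := Some (snd p), moved := False \<rparr>
                else a\<lparr> node := neighbour n p, on_side := None, moved := True \<rparr>)
             else a\<lparr> moved := False \<rparr>)"

text \<open>Passive transport: an agent asleep on a port is carried over the edge if it is present.\<close>

definition passive_update :: "nat \<Rightarrow> nat option \<Rightarrow> 'm agent \<Rightarrow> 'm agent" where
  "passive_update n missing a =
     (case on_side a of
        None \<Rightarrow> a
      | Some s \<Rightarrow>
          if missing = Some (port_edge n (node a, s)) then a
          else a\<lparr> node := neighbour n (node a, s), on_side := None \<rparr>)"

definition pt_round ::
  "nat \<Rightarrow> nat option \<Rightarrow> nat \<Rightarrow> 'm protocol \<Rightarrow> (nat \<Rightarrow> orientation) \<Rightarrow> nat set \<Rightarrow> nat option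
    \<Rightarrow> 'm config \<Rightarrow> 'm config \<Rightarrow> bool" where
  "pt_round n landmark k P lam active missing c c' \<longleftrightarrow>
     (\<exists>winners. valid_winners landmark k P lam c active winners \<and>
        (\<forall>i<k. c' i =
           (if i \<in> active then active_update n landmark k P lam missing winners c i
            else passive_update n missing (c i))))"

definition initial_config :: "nat \<Rightarrow> nat \<Rightarrow> 'm protocol \<Rightarrow> 'm config \<Rightarrow> bool" where
  "initial_config n k P c \<longleftrightarrow>
     (\<forall>i<k. node (c i) < n \<and> on_side (c i) = None \<and>
            memory (c i) = initial_memory P \<and> \<not> moved (c i))"

text \<open>Semi-synchronous executions in the passive transport model. The orientations \<open>lam\<close> of
  different agents are unrelated (no chirality); \<open>missing t\<close> is the edge missing in round \<open>t\<close>,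
  if any.\<close>

definition pt_execution ::
  "nat \<Rightarrow> nat option \<Rightarrow> nat \<Rightarrow> 'm protocol \<Rightarrow> (nat \<Rightarrow> orientation) \<Rightarrow> (nat \<Rightarrow> nat set)
    \<Rightarrow> (nat \<Rightarrow> nat option) \<Rightarrow> (nat \<Rightarrow> 'm config) \<Rightarrow> bool" where
  "pt_execution n landmark k P lam active missing c \<longleftrightarrow>
     (\<forall>i<k. consistent_orientation n (lam i)) \<and>
     initial_config n k P (c 0) \<and>
     (\<forall>t. active t \<noteq> {} \<and> active t \<subseteq> {..<k}) \<and>
     (\<forall>i<k. \<forall>t. \<exists>t'\<ge>t. i \<in> active t') \<and>
     (\<forall>t. set_option (missing t) \<subseteq> {..<n}) \<and>
     (\<forall>t. pt_round n landmark k P lam (active t) (missing t) (c t) (c (Suc t)))"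

definition explored :: "nat \<Rightarrow> nat \<Rightarrow> (nat \<Rightarrow> 'm config) \<Rightarrow> bool" where
  "explored n k c \<longleftrightarrow> (\<exists>T. \<forall>v<n. \<exists>t\<le>T. \<exists>i<k. node (c t i) = v)"

definition solves_exploration :: "nat \<Rightarrow> nat option \<Rightarrow> nat \<Rightarrow> 'm protocol \<Rightarrow> bool" where
  "solves_exploration n landmark k P \<longleftrightarrow>
     (\<forall>lam active missing c.
        pt_execution n landmark k P lam active missing c \<longrightarrow> explored n k c)"

end

theory Submission
  imports Defs
begin

text \<open>Consider an agent alone on a path of two nodes whose two outgoing edges are walls, i.e. are
  missing whenever it tries to cross them. Two disjoint mirrored copies of this path fit on four
  consecutive nodes, leaving out the landmark, in such a way that the two inner walls are the same
  edge. The adversary lets both agents replay the same solitary run on their copies. At the inner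
  wall they are blocked together. At the outer walls, where passive transport would release one of
  them, they are blocked one after the other: the first agent is activated alone until it is about
  to turn around; as it leaves, the second one hits its own outer wall and then catches up. This
  works unless the solitary run ends up pressing against the outer wall forever, and one of the two
  ways of orienting the copies avoids that.\<close>

section \<open>The solitary run\<close>

text \<open>The walker's end \<open>d\<close> is the node of the path whose port in direction \<open>d\<close> leads to a wall.\<close>

record 'm walker =
  path_end :: direction
  at_wall :: bool
  walker_memory :: 'm
  walker_moved :: bool

text \<open>The edge inside the path is never missing, so the only port on which a walker can rest
  is the one at its wall.\<close>

definition walker_decision :: "'m protocol \<Rightarrow> 'm walker \<Rightarrow> 'm \<times> direction option" where
  "walker_decision P w = compute P (walker_memory w) (walker_moved w)
     \<lparr> own_position = (if at_wall w then Some (path_end w) else None),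
       other_positions = {#}, sees_landmark = False \<rparr>"

definition walker_step :: "'m protocol \<Rightarrow> 'm walker \<Rightarrow> 'm walker" where
  "walker_step P w =
     (let w' = w\<lparr> walker_memory := fst (walker_decision P w) \<rparr>
      in case snd (walker_decision P w) of
           None \<Rightarrow> w'
         | Some d \<Rightarrow>
             if d = path_end w then w'\<lparr> at_wall := True, walker_moved := False \<rparr>
             else w'\<lparr> path_end := d, at_wall := False, walker_moved := True \<rparr>)"

text \<open>The starting end is fixed here; which end faces the other agent is chosen later through
  \<open>inner\<close> and \<open>outer\<close>.\<close>

primrec walk :: "'m protocol \<Rightarrow> nat \<Rightarrow> 'm walker" where
  "walk P 0 = \<lparr> path_end = Left, at_wall = False,
                walker_memory = initial_memory P, walker_moved = False \<rparr>"
| "walk P (Suc t) = walker_step P (walk P t)"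

definition pressing :: "direction \<Rightarrow> 'm walker \<Rightarrow> bool" where
  "pressing d w \<longleftrightarrow> at_wall w \<and> path_end w = d"

text \<open>A step from the opposite wall towards \<open>d\<close> crosses the path and ends off the
  ports; reaching the wall takes one more step.\<close>

lemma not_at_wall_before_pressing:
  "\<lbrakk>pressing d (walker_step P w); \<not> pressing d w\<rbrakk> \<Longrightarrow> \<not> at_wall w"
  by (auto simp: pressing_def walker_step_def Let_def split: option.splits if_splits)

lemma not_at_wall_after_pressing:
  "\<lbrakk>pressing d w; \<not> pressing d (walker_step P w)\<rbrakk> \<Longrightarrow> \<not> at_wall (walker_step P w)"
  by (auto simp: pressing_def walker_step_def Let_def split: option.splits if_splits)


section \<open>Two mirrored copies on the ring\<close>

lemma mod_offset_eq_iff: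
  fixes n l a b :: nat
  assumes "a < n" "b < n"
  shows "(l + a) mod n = (l + b) mod n \<longleftrightarrow> a = b"
proof -
  have "(l + a) mod n = (l + b) mod n \<longleftrightarrow> a mod n = b mod n"
    by (simp add: nat_mod_eq_iff add.assoc)
  then show ?thesis using assms by simp
qed

locale mirrored_walks =
  fixes n l :: nat and landmark :: "nat option" and P :: "'m protocol"
    and inner outer :: direction
  assumes size: "n \<ge> 5" and l_less: "l < n"
    and landmark: "set_option landmark \<subseteq> {l}"
    and inner_neq_outer: "inner \<noteq> outer"
    and released: "\<And>t. \<exists>t' > t. \<not> pressing outer (walk P t')"
begin

lemma direction_cases: "d = inner \<or> d = outer"
  using inner_neq_outer by (cases d; cases inner; cases outer) auto

definition face :: "nat \<Rightarrow> direction \<Rightarrow> side" where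
  "face i d = (if (d = inner) = (i = 0) then Plus else Minus)"

definition lam :: "nat \<Rightarrow> orientation" where
  "lam i p = (if (snd p = Plus) = (i = 0) then inner else outer)"

text \<open>The nodes \<open>l + 1\<close> to \<open>l + 4\<close> are, in order, the outer and
  inner end of copy 0 and the inner and outer end of copy 1. The inner ends are adjacent. For
  \<open>n = 5\<close> both outer walls lead to \<open>l\<close>, but over different edges.\<close>

definition home :: "nat \<Rightarrow> direction \<Rightarrow> nat" where
  "home i d = (l + (if i = 0 then if d = inner then 2 else 1
                    else if d = inner then 3 else 4)) mod n"

definition wall :: "nat \<Rightarrow> direction \<Rightarrow> nat" where
  "wall i d = port_edge n (home i d, face i d)"

definition place :: "nat \<Rightarrow> 'm walker \<Rightarrow> 'm agent" where
  "place i w = \<lparr> node = home i (path_end w),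
                 on_side = (if at_wall w then Some (face i (path_end w)) else None),
                 memory = walker_memory w, moved = walker_moved w \<rparr>"

lemma consistent_lam: "consistent_orientation n (lam i)"
  using inner_neq_outer by (auto simp: consistent_orientation_def lam_def)

lemma lam_face [simp]: "lam i (v, face i d) = d"
  using direction_cases[of d] inner_neq_outer by (auto simp: lam_def face_def)

lemma port_towards_lam [simp]: "port_towards (lam i) v d = (v, face i d)"
  using direction_cases[of d] inner_neq_outer
  by (auto simp: port_towards_def lam_def face_def)

lemma pred_mod: "((l + Suc k) mod n + n - 1) mod n = (l + k) mod n"
proof -
  have "(l + Suc k) mod n + n - 1 = (l + Suc k) mod n + (n - 1)"
    using size by simp
  then have "((l + Suc k) mod n + n - 1) mod n = (l + Suc k + (n - 1)) mod n"
    by (simp add: mod_add_left_eq)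
  also have "l + Suc k + (n - 1) = l + k + n" using size by simp
  finally show ?thesis by simp
qed

lemmas pred_mod_numeral = pred_mod[of 0] pred_mod[of 1] pred_mod[of 2] pred_mod[of 3]

lemma neighbour_home: "d' \<noteq> d \<Longrightarrow> neighbour n (home i d, face i d') = home i d'"
  using direction_cases[of d] direction_cases[of d'] inner_neq_outer pred_mod_numeral
  by (auto simp: home_def face_def mod_Suc_eq numeral_eq_Suc)

lemma wall_eq: "wall i d = (l + (if d = inner then 2 else if i = 0 then 0 else 4)) mod n"
  using pred_mod_numeral by (simp add: wall_def home_def face_def numeral_eq_Suc)

lemma crossing_eq:
  "d' \<noteq> d \<Longrightarrow> port_edge n (home i d, face i d') = (l + (if i = 0 then 1 else 3)) mod n"
  using pred_mod_numeral direction_cases[of d] direction_cases[of d'] inner_neq_outer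
  by (auto simp: home_def face_def numeral_eq_Suc)

lemma wall_less: "wall i d < n"
  using size by (simp add: wall_eq)

text \<open>Walls have offsets 0, 2, 4 and crossings 1, 3, all distinct as \<open>n\<close> is at
  least 5. So a missing wall never stops a crossing.\<close>

lemma crossing_neq_wall: "d' \<noteq> d \<Longrightarrow> port_edge n (home i d, face i d') \<noteq> wall j e"
  using size by (simp add: crossing_eq wall_eq mod_offset_eq_iff)

lemma home_neq_l: "home i d \<noteq> l"
  using size l_less mod_offset_eq_iff[of _ n 0 l] by (simp add: home_def)

lemma home_disjoint:
  assumes "i < 2" "j < 2" "i \<noteq> j"
  shows "home i d \<noteq> home j e"
  using size assms by (auto simp: home_def mod_offset_eq_iff)

lemma place_simps [simp]:
  "node (place i w) = home i (path_end w)"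
  "on_side (place i w) = (if at_wall w then Some (face i (path_end w)) else None)"
  "memory (place i w) = walker_memory w"
  "moved (place i w) = walker_moved w"
  by (auto simp: place_def)

section \<open>Simulation of the walker by the agents\<close>

lemma decision_place:
  assumes c: "\<And>i. c i = place i (w i)" and i: "i < 2"
  shows "decision landmark 2 P lam c i = walker_decision P (w i)"
proof -
  have alone: "{j. j < 2 \<and> j \<noteq> i \<and> node (c j) = node (c i)} = {}"
    using i home_disjoint by (auto simp: c)
  have "landmark \<noteq> Some (node (c i))"
    using landmark home_neq_l by (auto simp: c)
  then show ?thesis
    unfolding decision_def look_def alone walker_decision_def
    by (auto simp: position_seen_def c)
qed

lemma wanted_port_place:
  assumes c: "\<And>i. c i = place i (w i)" and i: "i < 2"
  shows "wanted_port landmark 2 P lam c i =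
    map_option (\<lambda>d. (home i (path_end (w i)), face i d)) (snd (walker_decision P (w i)))"
  by (cases "snd (walker_decision P (w i))")
    (simp_all add: wanted_port_def decision_place[OF assms], simp add: c)

text \<open>The copies share no node, hence no port: no port has two contenders, and all contenders
  can win.\<close>

lemma valid_winners_place:
  assumes c: "\<And>i. c i = place i (w i)" and act: "active \<subseteq> {..<2}"
  shows "valid_winners landmark 2 P lam c active
    (\<Union>p. contenders landmark 2 P lam c active p)"
proof -
  have "i = j"
    if "i \<in> contenders landmark 2 P lam c active p"
      "j \<in> contenders landmark 2 P lam c active q" "p = q" for i j p q
  proof (rule ccontr)
    assume "i \<noteq> j"
    have "i < 2" "j < 2" using that act by (auto simp: contenders_def)
    then show False
      using that home_disjoint[OF _ _ \<open>i \<noteq> j\<close>]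
      by (auto simp: contenders_def wanted_port_place[OF c])
  qed
  moreover have "p = q"
    if "i \<in> contenders landmark 2 P lam c active p"
      "i \<in> contenders landmark 2 P lam c active q" for i p q
    using that by (auto simp: contenders_def)
  ultimately show ?thesis
    unfolding valid_winners_def by blast
qed

text \<open>The choice of wall matters only if the step ends at a wall: crossings stay open as
  \<open>e\<close> is some wall, and active agents are not transported.\<close>

lemma active_update_place:
  assumes c: "\<And>i. c i = place i (w i)" and i: "i < 2" "i \<in> active"
    and e: "e \<in> range (case_prod wall)"
    and blocked: "at_wall (walker_step P (w i)) \<Longrightarrow> e = wall i (path_end (walker_step P (w i)))"
  shows "active_update n landmark 2 P lam (Some e)
    (\<Union>p. contenders landmark 2 P lam c active p) c i = place i (walker_step P (w i))"
proof (cases "snd (walker_decision P (w i))")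
  case None
  then show ?thesis
    by (simp add: active_update_def wanted_port_place[OF c i(1)] decision_place[OF c i(1)]
        walker_step_def c place_def)
next
  case (Some d)
  let ?p = "(home i (path_end (w i)), face i d)"
  have wanted: "wanted_port landmark 2 P lam c i = Some ?p"
    using Some by (simp add: wanted_port_place[OF c i(1)])
  have other: "\<not> on_port (c j) ?p" if "j < 2" "j \<noteq> i" for j
    using that i home_disjoint[of j i] by (auto simp: on_port_def c)
  have gain: "on_port (c i) ?p \<or> i \<in> (\<Union>p. contenders landmark 2 P lam c active p)"
    using i wanted other by (auto simp: contenders_def)
  show ?thesis
  proof (cases "d = path_end (w i)")
    case True
    then have "e = port_edge n ?p"
      using blocked Some by (simp add: walker_step_def wall_def)
    then show ?thesis
      using gain Some True
      by (simp add: active_update_def wanted decision_place[OF c i(1)] on_port_def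
          walker_step_def Let_def c place_def)
  next
    case False
    obtain j f where "e = wall j f" using e by auto
    then have "e \<noteq> port_edge n ?p"
      using crossing_neq_wall[of d "path_end (w i)" i j f] False by simp
    then show ?thesis
      using gain Some False
      by (simp add: active_update_def wanted decision_place[OF c i(1)] on_port_def
          walker_step_def Let_def neighbour_home c place_def)
  qed
qed

lemma passive_update_place: "\<not> at_wall w \<Longrightarrow> passive_update n e (place i w) = place i w"
  by (simp add: passive_update_def)


section \<open>The schedule\<close>

text \<open>A pair \<open>(i, j)\<close> means that agent \<open>0\<close> has performed \<open>i\<close> and agent \<open>1\<close> has performed \<open>j\<close> steps
  of the solitary run.\<close>

definition pressing_at :: "nat \<Rightarrow> bool" where
  "pressing_at t \<longleftrightarrow> pressing outer (walk P t)"

text \<open>Level agents step together until the next step would press the outer wall. Then agent 1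
  waits during agent 0's stay there, joins in the round in which agent 0 leaves, and goes on alone
  until level.\<close>

fun runs :: "nat \<Rightarrow> nat \<times> nat \<Rightarrow> bool" where
  "runs k (i, j) \<longleftrightarrow>
     (let leader = (i = j \<or> pressing_at i)
      in if k = 0 then leader else \<not> leader \<or> \<not> pressing_at (Suc i))"

text \<open>The inner wall serves both level agents. In the last case agent 0 is leaving its outer
  wall or waits off the ports, so only agent 1 may need a wall.\<close>

fun blocked_edge :: "nat \<times> nat \<Rightarrow> nat" where
  "blocked_edge (i, j) =
     (if \<not> runs 1 (i, j) then wall 0 outer
      else if i = j then wall 0 inner else wall 1 outer)"

primrec progress :: "nat \<Rightarrow> nat \<times> nat" where
  "progress 0 = (0, 0)"
| "progress (Suc t) =
     (let (i, j) = progress t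
      in (if runs 0 (i, j) then Suc i else i, if runs 1 (i, j) then Suc j else j))"

definition steps :: "nat \<Rightarrow> nat \<Rightarrow> nat" where
  "steps t k = (if k = 0 then fst (progress t) else snd (progress t))"

definition configs :: "nat \<Rightarrow> 'm config" where
  "configs t k = place k (walk P (steps t k))"

definition activation :: "nat \<Rightarrow> nat set" where
  "activation t = {k. k < 2 \<and> runs k (progress t)}"

text \<open>The three cases: the agents are level, the first one is at its outer wall, or it has already
  left and the second one is at its outer wall.\<close>

fun in_phase :: "nat \<times> nat \<Rightarrow> bool" where
  "in_phase (i, j) \<longleftrightarrow>
     i = j \<and> \<not> pressing_at i \<or>
     j < i \<and> (\<forall>t. j < t \<and> t \<le> i \<longrightarrow> pressing_at t) \<and> \<not> at_wall (walk P j) \<or>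
     j < i \<and> (\<forall>t. j \<le> t \<and> t < i \<longrightarrow> pressing_at t) \<and> \<not> at_wall (walk P i)"

lemma not_at_wall_before:
  "\<lbrakk>pressing_at (Suc t); \<not> pressing_at t\<rbrakk> \<Longrightarrow> \<not> at_wall (walk P t)"
  using not_at_wall_before_pressing by (fastforce simp: pressing_at_def)

lemma not_at_wall_after:
  "\<lbrakk>pressing_at t; \<not> pressing_at (Suc t)\<rbrakk> \<Longrightarrow> \<not> at_wall (walk P (Suc t))"
  using not_at_wall_after_pressing by (fastforce simp: pressing_at_def)

lemma not_at_wall_not_pressing: "\<not> at_wall (walk P t) \<Longrightarrow> \<not> pressing_at t"
  by (simp add: pressing_at_def pressing_def)

text \<open>The phases recur cyclically. A stay at the outer wall is preceded and followed by a
  state off the ports, which is where the waiting agent sleeps.\<close>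

lemma in_phase_progress: "in_phase (progress t)"
proof (induction t)
  case 0
  show ?case by (simp add: pressing_at_def pressing_def)
next
  case (Suc t)
  obtain i j where ij: "progress t = (i, j)" by fastforce
  from Suc ij consider "i = j" "\<not> pressing_at i"
    | "j < i" "\<forall>t. j < t \<and> t \<le> i \<longrightarrow> pressing_at t" "\<not> at_wall (walk P j)"
    | "j < i" "\<forall>t. j \<le> t \<and> t < i \<longrightarrow> pressing_at t" "\<not> at_wall (walk P i)"
    by auto
  then show ?case
  proof cases
    case 1
    then show ?thesis
      using ij not_at_wall_before[of i] by (auto simp: le_Suc_eq simp del: walk.simps)
  next
    case 2
    then show ?thesis
      using ij not_at_wall_after[of i] by (auto simp: le_Suc_eq less_Suc_eq simp del: walk.simps)
  next
    case 3
    then show ?thesis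
      using ij not_at_wall_not_pressing[of i]
      by (auto simp: Suc_le_eq simp del: walk.simps)
  qed
qed

lemma steps_Suc: "steps (Suc t) k = (if runs k (progress t) then Suc (steps t k) else steps t k)"
  by (auto simp: steps_def Let_def split: prod.splits)

lemma sleeper_not_at_wall:
  assumes "k < 2" "\<not> runs k (progress t)"
  shows "\<not> at_wall (walk P (steps t k))"
proof -
  obtain i j where ij: "progress t = (i, j)" by fastforce
  then show ?thesis
    using assms in_phase_progress[of t] not_at_wall_before[of i] not_at_wall_not_pressing[of i]
    by (auto simp: steps_def split: if_splits simp del: walk.simps)
qed

lemma runner_at_wall_blocked:
  assumes "k < 2" "runs k (progress t)" and wall: "at_wall (walk P (Suc (steps t k)))"
  shows "blocked_edge (progress t) = wall k (path_end (walk P (Suc (steps t k))))"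
proof -
  obtain i j where ij: "progress t = (i, j)" by fastforce
  have inner: "path_end (walk P (Suc s)) = inner"
    if "\<not> pressing_at (Suc s)" "at_wall (walk P (Suc s))" for s
    using that direction_cases by (auto simp: pressing_at_def pressing_def)
  have outer: "path_end (walk P s) = outer" if "pressing_at s" for s
    using that by (simp add: pressing_at_def pressing_def)
  consider "k = 0" | "k = 1" using assms(1) by linarith
  then show ?thesis
  proof cases
    case 1
    then have run: "i = j \<or> pressing_at i" and wall: "at_wall (walk P (Suc i))"
      using ij assms by (auto simp: steps_def)
    show ?thesis
    proof (cases "pressing_at (Suc i)")
      case True
      then show ?thesis using 1 ij run outer[OF True] by (auto simp: steps_def)
    next
      case False
      then have "i = j" using run wall not_at_wall_after by blast
      then show ?thesis using 1 ij False inner[OF False wall] by (simp add: steps_def)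
    qed
  next
    case 2
    then have run: "i = j \<or> pressing_at i \<Longrightarrow> \<not> pressing_at (Suc i)"
      and runs: "runs 1 (i, j)" and wall: "at_wall (walk P (Suc j))"
      using ij assms by (auto simp: steps_def)
    show ?thesis
    proof (cases "i = j")
      case True
      then have "path_end (walk P (Suc j)) = inner" using run wall inner by blast
      then show ?thesis using 2 ij True runs by (simp add: steps_def wall_eq)
    next
      case False
      \<comment> \<open>If agent 0 has left its wall and \<open>Suc j = i\<close>, the step of agent
        1 ends off the ports, against \<open>wall\<close>. Otherwise \<open>Suc j\<close> lies
        within the stay.\<close>
      have "pressing_at (Suc j)"
        using False in_phase_progress[of t] ij wall
        by (auto simp del: walk.simps) (metis Suc_leI le_less lessI)+
      then show ?thesis
        using 2 ij False runs outer[of "Suc j"] by (simp add: steps_def del: walk.simps)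
    qed
  qed
qed

lemma pt_round_configs:
  "pt_round n landmark 2 P lam (activation t) (Some (blocked_edge (progress t)))
     (configs t) (configs (Suc t))"
proof -
  have c: "\<And>k. configs t k = place k (walk P (steps t k))"
    by (simp add: configs_def)
  have act: "activation t \<subseteq> {..<2}" by (auto simp: activation_def)
  have edge: "blocked_edge (progress t) \<in> range (case_prod wall)"
    by (cases "progress t") auto
  show ?thesis
    unfolding pt_round_def
  proof (intro exI conjI allI impI)
    show "valid_winners landmark 2 P lam (configs t) (activation t)
      (\<Union>p. contenders landmark 2 P lam (configs t) (activation t) p)"
      by (rule valid_winners_place[OF c act])
    fix k :: nat
    assume k: "k < 2"
    show "configs (Suc t) k =
      (if k \<in> activation t
       then active_update n landmark 2 P lam (Some (blocked_edge (progress t)))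
         (\<Union>p. contenders landmark 2 P lam (configs t) (activation t) p) (configs t) k
       else passive_update n (Some (blocked_edge (progress t))) (configs t k))"
    proof (cases "runs k (progress t)")
      case True
      then have mem: "k \<in> activation t" using k by (simp add: activation_def)
      have "configs (Suc t) k = place k (walker_step P (walk P (steps t k)))"
        using True by (simp add: configs_def steps_Suc)
      then show ?thesis
        using active_update_place[OF c k mem edge] runner_at_wall_blocked[OF k True] mem by simp
    next
      case False
      then show ?thesis
        using sleeper_not_at_wall[OF k False]
        by (simp add: configs_def steps_Suc activation_def passive_update_place)
    qed
  qed
qed

section \<open>Fairness of the schedule\<close>

lemma runs_some: "runs 0 p \<or> runs 1 p"
  by (cases p) (auto simp: Let_def)

lemma sum_steps_ge: "t \<le> steps t 0 + steps t 1"
proof (induction t)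
  case (Suc t)
  then show ?case using runs_some[of "progress t"] by (auto simp: steps_Suc)
qed simp

lemma steps_asleep:
  assumes "\<And>t'. t' \<ge> t \<Longrightarrow> \<not> runs k (progress t')"
  shows "steps (t + u) k = steps t k"
  using assms by (induction u) (auto simp: steps_Suc)

lemma steps_order: "steps t 1 \<le> steps t 0"
  using in_phase_progress[of t] by (cases "progress t") (auto simp: steps_def)

lemma pressing_between:
  "\<lbrakk>steps t 1 < s; s < steps t 0\<rbrakk> \<Longrightarrow> pressing_at s"
  using in_phase_progress[of t] by (cases "progress t") (auto simp: steps_def)

lemma runs_infinitely_often:
  assumes "k < 2"
  shows "\<exists>t' \<ge> t. runs k (progress t')"
proof (rule ccontr)
  assume "\<not> ?thesis"
  then have asleep: "steps (t + u) k = steps t k" for u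
    using steps_asleep by auto
  consider "k = 0" | "k = 1" using assms by linarith
  then show False
  proof cases
    case 1
    define u where "u = Suc (2 * steps t 0)"
    have "t + u \<le> steps (t + u) 0 + steps (t + u) 1" by (rule sum_steps_ge)
    also have "\<dots> \<le> 2 * steps (t + u) 0" using steps_order[of "t + u"] by simp
    also have "steps (t + u) 0 = steps t 0" using asleep[of u] 1 by simp
    finally show False by (simp add: u_def)
  next
    case 2
    obtain s where s: "steps t 1 < s" "\<not> pressing_at s"
      using released unfolding pressing_at_def by blast
    \<comment> \<open>With agent 1 frozen, this many rounds take agent 0 beyond \<open>s\<close>,
      although all states strictly between the two counts are pressing.\<close>
    define u where "u = Suc (s + steps t 1)"
    have "t + u \<le> steps (t + u) 0 + steps (t + u) 1" by (rule sum_steps_ge)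
    also have "steps (t + u) 1 = steps t 1" using asleep[of u] 2 by simp
    finally have "s < steps (t + u) 0" by (simp add: u_def)
    moreover have "steps (t + u) 1 < s" using asleep[of u] 2 s by simp
    ultimately show False using pressing_between s by blast
  qed
qed

section \<open>The execution and its unvisited node\<close>

lemma pt_execution_configs:
  "pt_execution n landmark 2 P lam activation (\<lambda>t. Some (blocked_edge (progress t))) configs"
  unfolding pt_execution_def
proof (intro conjI allI impI)
  show "initial_config n 2 P (configs 0)"
    using size by (auto simp: initial_config_def configs_def steps_def home_def)
  fix t
  have "0 \<in> activation t \<or> 1 \<in> activation t"
    using runs_some[of "progress t"] by (simp add: activation_def)
  then show "activation t \<noteq> {}" by blast
  show "activation t \<subseteq> {..<2}" by (auto simp: activation_def)
  show "set_option (Some (blocked_edge (progress t))) \<subseteq> {..<n}"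
    by (cases "progress t") (auto simp: wall_less)
  fix k :: nat
  assume "k < 2"
  then show "\<exists>t' \<ge> t. k \<in> activation t'"
    using runs_infinitely_often by (auto simp: activation_def)
qed (rule consistent_lam pt_round_configs)+

lemma not_solves_exploration: "\<not> solves_exploration n landmark 2 P"
proof
  assume "solves_exploration n landmark 2 P"
  then have "explored n 2 configs"
    using pt_execution_configs unfolding solves_exploration_def by blast
  then obtain t i where "node (configs t i) = l"
    using l_less unfolding explored_def by blast
  then show False by (simp add: configs_def home_neq_l)
qed

end

theorem theorem10:
  fixes n :: nat and landmark :: "nat option" and P :: "'m protocol"
  assumes "n \<ge> 5"
    and "set_option landmark \<subseteq> {..<n}"
  shows "\<not> solves_exploration n landmark 2 P"
proof -
  \<comment> \<open>Without a landmark any node can be the one left out.\<close>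
  define l where "l = (case landmark of None \<Rightarrow> 0 | Some v \<Rightarrow> v)"
  have l: "l < n" "set_option landmark \<subseteq> {l}"
    using assms by (auto simp: l_def split: option.splits)
  have unsolved: ?thesis
    if "inner \<noteq> outer" "\<And>t. \<exists>t' > t. \<not> pressing outer (walk P t')" for inner outer
  proof -
    interpret mirrored_walks n l landmark P inner outer
      by (rule mirrored_walks.intro[OF assms(1) l that])
    show ?thesis by (rule not_solves_exploration)
  qed
  show ?thesis
  proof (cases "\<forall>t. \<exists>t' > t. \<not> pressing Left (walk P t')")
    case True
    then show ?thesis using unsolved[of Right Left] by blast
  next
    case False
    then obtain t where t: "pressing Left (walk P t')" if "t' > t" for t' by blast
    \<comment> \<open>A walker that presses \<open>Left\<close> forever does not press
      \<open>Right\<close>, so exchanging the roles of the ends helps.\<close>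
    have "\<exists>t' > s. \<not> pressing Right (walk P t')" for s
      using t[of "Suc (max s t)"] by (intro exI[of _ "Suc (max s t)"]) (simp add: pressing_def)
    then show ?thesis using unsolved[of Left Right] by blast
  qed
qed

end
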